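(* Let $n \ge 1$ and $t \ge 1$ be integers, and let $\alpha, \beta, \theta \in \mathbb{F}_{3^n}^*$. Define $f: \mathbb{F}_{3^n} \to \mathbb{F}_{3^n}$ by $$f(x) = \begin{cases} 0 & \text{if } x = 0, \\ \alpha x^t & \text{if } x \in C_0, \\ \beta(x^3 + \theta x^2 + \theta^2 x) & \text{if } x \in C_1. \end{cases}$$ Suppose $f$ is a permutation of $\mathbb{F}_{3^n}$ and $\eta(\alpha) = (-1)^m$ with $m \in \{0,1\}$. Then the inverse of $f$ on $\mathbb{F}_{3^n}$ is $$f^{-1}(x) = -u(x)\left(1 + (-1)^m x^{(3^n-1)/2}\right) - v(x)\left(1 + (-1)^{m+1} x^{(3^n-1)/2}\right),$$ where: - $u(x) = (\alpha^{-1} x)^s$, with $s$ the inverse of $t$ modulo $(3^n-1)/2$; - $v(x) = \sum_{0 \le j,k \le n-1} \theta \left(\beta^{-1}\theta^{-3} x\right)^{\frac{3^j+3^k}{2}}$.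
   Context: $C_0 = \{e^2 : e \in \mathbb{F}_{3^n}^*\}$ and $C_1 = \mathbb{F}_{3^n}^* \setminus C_0$. $\eta$ is the quadratic character of $\mathbb{F}_{3^n}$: $\eta(a) = 1$ on $C_0$ and $-1$ on $C_1$. The inverse of $f$ is a polynomial $g$ with $g(f(c)) = c$ for all $c \in \mathbb{F}_{3^n}$. It is known that such $f$ is a permutation if and only if $\gcd(t, \frac{3^n-1}{2}) = 1$, $\eta(\theta) = 1$ and $\eta(\alpha) = \eta(\beta)$; in particular $s$ exists. *)

theory Defs
  imports
    "HOL-Library.Cardinality"
    "HOL-Computational_Algebra.Polynomial"
    "HOL-Number_Theory.Cong"
begin

definition C0 :: "'a::field set" where
  "C0 = {e\<^sup>2 | e. e \<noteq> 0}"

definition C1 :: "'a::field set" where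
  "C1 = (UNIV - {0}) - C0"

(* The value at 0 is the usual convention for multiplicative characters. *)
definition quadratic_character :: "'a::field \<Rightarrow> int" where
  "quadratic_character a = (if a \<in> C0 then 1 else if a \<in> C1 then - 1 else 0)"

definition f_map :: "nat \<Rightarrow> 'a::field \<Rightarrow> 'a \<Rightarrow> 'a \<Rightarrow> 'a \<Rightarrow> 'a" where
  "f_map t \<alpha> \<beta> \<theta> x =
     (if x = 0 then 0
      else if x \<in> C0 then \<alpha> * x ^ t
      else \<beta> * (x ^ 3 + \<theta> * x\<^sup>2 + \<theta>\<^sup>2 * x))"

definition is_inverse_poly :: "'a::field poly \<Rightarrow> ('a \<Rightarrow> 'a) \<Rightarrow> bool" where
  "is_inverse_poly g f \<longleftrightarrow> (\<forall>c. poly g (f c) = c)"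

(* [:0, a:] is the polynomial a * x. *)

definition u_poly :: "nat \<Rightarrow> 'a::field \<Rightarrow> 'a poly" where
  "u_poly s \<alpha> = [:0, inverse \<alpha>:] ^ s"

(* The sum 3^j + 3^k is even, so div is exact. *)
definition v_poly :: "nat \<Rightarrow> 'a::field \<Rightarrow> 'a \<Rightarrow> 'a poly" where
  "v_poly n \<beta> \<theta> =
     (\<Sum>j\<in>{0..n - 1}. \<Sum>k\<in>{0..n - 1}.
        smult \<theta> ([:0, inverse \<beta> * inverse (\<theta> ^ 3):] ^ ((3 ^ j + 3 ^ k) div 2)))"

definition f_inverse_poly ::
  "nat \<Rightarrow> nat \<Rightarrow> nat \<Rightarrow> 'a::field \<Rightarrow> 'a \<Rightarrow> 'a \<Rightarrow> 'a poly" where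
  "f_inverse_poly n m s \<alpha> \<beta> \<theta> =
     - u_poly s \<alpha> * (1 + monom ((- 1) ^ m) ((3 ^ n - 1) div 2))
     - v_poly n \<beta> \<theta> * (1 + monom ((- 1) ^ (m + 1)) ((3 ^ n - 1) div 2))"

end

theory Submission
  imports Defs "HOL-Number_Theory.Residues"
begin

text \<open>
  Put \<open>h = (3\<^sup>n - 1) / 2\<close>. By Euler's criterion \<open>1 \<plusminus> (-1)\<^sup>m y\<^sup>h\<close> selects the branch through which
  \<open>y\<close> is attained: \<open>f\<close> maps \<open>C\<^sub>0\<close> onto \<open>\<alpha> C\<^sub>0\<close> because \<open>t\<close> is invertible modulo \<open>h\<close>, so by
  injectivity \<open>f c / \<alpha>\<close> is a nonsquare for \<open>c \<in> C\<^sub>1\<close>. Moreover \<open>\<theta>\<close> is a square, as otherwise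
  \<open>f \<theta> = 3 \<beta> \<theta>\<^sup>3 = 0 = f 0\<close>. On \<open>C\<^sub>1\<close> put \<open>w = c / \<theta>\<close>, a nonsquare; then \<open>f c / (\<beta> \<theta>\<^sup>3)\<close> equals
  \<open>w\<^sup>3 + w\<^sup>2 + w = w (w - 1)\<^sup>2\<close> in characteristic 3. In terms of a square root \<open>d\<close> of \<open>w\<close> in an
  extension field this is \<open>(d\<^sup>3 - d)\<^sup>2\<close>, whence \<open>v\<close> is \<open>\<theta>\<close> times the square of the
  telescoping sum over \<open>j < n\<close> of \<open>(d\<^sup>3 - d)\<^bsup>3^j\<^esup>\<close>, which is \<open>d\<^bsup>3^n\<^esup> - d = -2 d = d\<close>.
  Dividing every summand by \<open>d\<close> keeps the computation inside the field.
\<close>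

section \<open>Euler's criterion in a finite field\<close>

lemma finite_field_power_card_minus_1:
  fixes a :: "'a::{field,finite}"
  assumes "a \<noteq> 0"
  shows "a ^ (CARD('a) - 1) = 1"
proof -
  let ?U = "UNIV - {0::'a}"
  have "bij_betw ((*) a) ?U ?U"
    by (rule bij_betwI[where g = "\<lambda>x. x / a"]) (use assms in auto)
  then have "(\<Prod>x\<in>?U. a * x) = \<Prod>?U"
    by (rule prod.reindex_bij_betw)
  then have "a ^ card ?U * \<Prod>?U = \<Prod>?U"
    by (simp add: prod.distrib)
  moreover have "\<Prod>?U \<noteq> 0"
    by simp
  ultimately show ?thesis
    by (simp add: card_Diff_singleton)
qed

lemma finite_field_power_half_cases:
  fixes a :: "'a::{field,finite}"
  assumes "odd CARD('a)" "a \<noteq> 0"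
  shows "a ^ ((CARD('a) - 1) div 2) = 1 \<or> a ^ ((CARD('a) - 1) div 2) = - 1"
proof -
  have "(a ^ ((CARD('a) - 1) div 2))\<^sup>2 = a ^ (CARD('a) - 1)"
    using assms(1) by (simp flip: power_mult)
  then show ?thesis
    using finite_field_power_card_minus_1[OF assms(2)] by (simp add: power2_eq_1_iff)
qed

lemma C0_imp_power_half:
  fixes a :: "'a::{field,finite}"
  assumes "odd CARD('a)" "a \<in> C0"
  shows "a ^ ((CARD('a) - 1) div 2) = 1"
proof -
  from assms(2) obtain e where e: "a = e\<^sup>2" "e \<noteq> 0"
    by (auto simp: C0_def)
  have "(e\<^sup>2) ^ ((CARD('a) - 1) div 2) = e ^ (CARD('a) - 1)"
    using assms(1) by (simp flip: power_mult)
  then show ?thesis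
    using finite_field_power_card_minus_1[OF e(2)] e(1) by simp
qed

text \<open>Squaring is at most two-to-one. This bound makes the root count in Euler's criterion
  tight.\<close>

lemma card_nonzero_le_2_card_C0:
  "CARD('a) - 1 \<le> 2 * card (C0 :: 'a::{field,finite} set)"
proof -
  have "UNIV - {0::'a} \<subseteq> (\<Union>y\<in>C0. {x. x\<^sup>2 = y})"
    by (auto simp: C0_def)
  then have "card (UNIV - {0::'a}) \<le> card (\<Union>y\<in>(C0 :: 'a set). {x. x\<^sup>2 = y})"
    by (intro card_mono) auto
  also have "\<dots> \<le> (\<Sum>y\<in>(C0 :: 'a set). card {x. x\<^sup>2 = y})"
    by (intro card_UN_le) auto
  also have "\<dots> \<le> (\<Sum>y\<in>(C0 :: 'a set). 2)"
  proof (rule sum_mono)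
    fix y :: 'a assume "y \<in> C0"
    then obtain e where "y = e\<^sup>2"
      by (auto simp: C0_def)
    then have "{x. x\<^sup>2 = y} = {e, - e}"
      by (auto simp: power2_eq_iff)
    then show "card {x. x\<^sup>2 = y} \<le> 2"
      by (simp add: card_insert_if)
  qed
  finally show ?thesis
    by (simp add: card_Diff_singleton)
qed

lemma power_half_eq_1_iff_C0:
  fixes a :: "'a::{field,finite}"
  assumes "odd CARD('a)" "a \<noteq> 0"
  shows "a ^ ((CARD('a) - 1) div 2) = 1 \<longleftrightarrow> a \<in> C0"
proof -
  let ?h = "(CARD('a) - 1) div 2"
  let ?R = "{x::'a. x ^ ?h = 1}"
  have "CARD('a) > 1"
    using card_mono[of "UNIV :: 'a set" "{0, 1}"] by simp
  with assms(1) have h: "?h > 0"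
    by (auto elim!: oddE)
  define p :: "'a poly" where "p = Polynomial.monom 1 ?h - 1"
  have "degree p \<le> ?h"
    unfolding p_def by (intro degree_diff_le) (auto simp: degree_monom_le)
  \<comment> \<open>As \<open>?h > 0\<close>, the constant term cannot cancel the leading
    one.\<close>
  moreover have "Polynomial.coeff p ?h = 1"
    using h by (simp add: p_def)
  then have "p \<noteq> 0"
    by auto
  moreover have "{x. poly p x = 0} = ?R"
    by (auto simp: p_def poly_monom)
  ultimately have "card ?R \<le> ?h"
    using card_poly_roots_bound[of p] by simp
  also have "?h \<le> card (C0 :: 'a set)"
    using card_nonzero_le_2_card_C0[where 'a='a] by simp
  finally have "card ?R \<le> card (C0 :: 'a set)" .
  moreover have "(C0 :: 'a set) \<subseteq> ?R"
    using C0_imp_power_half[OF assms(1)] by blast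
  ultimately have "(C0 :: 'a set) = ?R"
    by (intro card_seteq) simp_all
  then show ?thesis
    by blast
qed

lemma power_half_eq_minus_1:
  fixes a :: "'a::{field,finite}"
  assumes "odd CARD('a)" "a \<noteq> 0" "a \<notin> C0"
  shows "a ^ ((CARD('a) - 1) div 2) = - 1"
  using assms finite_field_power_half_cases power_half_eq_1_iff_C0 by blast

lemma quadratic_character_eq_power_half:
  fixes a :: "'a::{field,finite}"
  assumes "odd CARD('a)" "a \<noteq> 0"
  shows "of_int (quadratic_character a) = a ^ ((CARD('a) - 1) div 2)"
  using C0_imp_power_half[OF assms(1), of a] power_half_eq_minus_1[OF assms] assms(2)
  by (cases "a \<in> C0") (simp_all only: quadratic_character_def C1_def, simp_all)

section \<open>Power sums in characteristic 3\<close>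

lemma CHAR_eq_3:
  assumes "CARD('a::{field,finite}) = 3 ^ n"
  shows "CHAR('a) = 3"
proof -
  have "prime CHAR('a)"
    by (simp add: finite_imp_CHAR_pos prime_CHAR_semidom)
  moreover have "CHAR('a) dvd 3 ^ n"
    using CHAR_dvd_CARD[where 'a='a] assms by simp
  ultimately show ?thesis
    using prime_dvd_power primes_dvd_imp_eq[of "CHAR('a)" 3] by auto
qed

lemma odd_add_div_2: "odd a \<Longrightarrow> odd b \<Longrightarrow> (a + b) div 2 = Suc (a div 2 + b div 2)" for a b :: nat
  by (elim oddE) simp

text \<open>With \<open>w = d^2\<close>, the j-th power is \<open>(d^3 - d)^(3^j - 1)\<close> and
  \<open>w - 1 = (d^3 - d) / d\<close>; their product is \<open>(d^3 - d)^(3^j) / d\<close>, a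
  difference of consecutive terms by Frobenius.\<close>

lemma sum_power_telescope_char3:
  fixes w :: "'a::field"
  assumes char: "CHAR('a) = 3"
  shows "(w - 1) * (\<Sum>j<n. (w * (w - 1)\<^sup>2) ^ (3 ^ j div 2)) = w ^ (3 ^ n div 2) - 1"
proof -
  have step: "(w - 1) * (w * (w - 1)\<^sup>2) ^ (3 ^ j div 2) = w ^ (3 ^ Suc j div 2) - w ^ (3 ^ j div 2)"
    for j
  proof -
    have odd: "odd (3 ^ j :: nat)"
      by simp
    then have e: "2 * (3 ^ j div 2) + 1 = (3 ^ j :: nat)"
      by presburger
    have s: "3 ^ Suc j div 2 = 3 ^ j div 2 + (3 ^ j :: nat)"
      using odd by simp
    have "((w - 1) + 1) ^ 3 ^ j = (w - 1) ^ 3 ^ j + 1 ^ 3 ^ j"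
      by (rule freshmans_dream') (simp_all add: char)
    then have frob: "(w - 1) ^ 3 ^ j = w ^ 3 ^ j - 1"
      by simp
    have "(w - 1) * (w * (w - 1)\<^sup>2) ^ (3 ^ j div 2)
        = w ^ (3 ^ j div 2) * (w - 1) ^ (2 * (3 ^ j div 2) + 1)"
      by (simp only: power_mult_distrib power_add power_mult power_one_right mult_ac)
    also have "\<dots> = w ^ (3 ^ j div 2) * (w ^ 3 ^ j - 1)"
      by (simp only: e frob)
    also have "\<dots> = w ^ (3 ^ Suc j div 2) - w ^ (3 ^ j div 2)"
      by (simp only: s power_add right_diff_distrib mult_1_right)
    finally show ?thesis .
  qed
  show ?thesis
    using sum_lessThan_telescope[of "\<lambda>j. w ^ (3 ^ j div 2)" n]
    by (simp only: sum_distrib_left step) simp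
qed

text \<open>Halving a sum of two odd numbers leaves a carry of 1, so the double sum factors as
  \<open>z * T^2\<close>; by telescoping, \<open>T\<close> is the inverse of
  \<open>w - 1\<close>.\<close>

lemma double_sum_char3:
  fixes w :: "'a::field"
  assumes char: "CHAR('a) = 3" and w: "w ^ (3 ^ n div 2) = - 1"
  shows "(\<Sum>j<n. \<Sum>k<n. (w * (w - 1)\<^sup>2) ^ ((3 ^ j + 3 ^ k) div 2)) = w"
proof -
  define z where "z = w * (w - 1)\<^sup>2"
  define T where "T = (\<Sum>j<n. z ^ (3 ^ j div 2))"
  have "(3::'a) = 0"
    using of_nat_CHAR[where 'a='a] char by simp
  then have "(- 1 :: 'a) - 1 = 1"
    by (simp add: algebra_simps)
  then have T: "(w - 1) * T = 1"
    using sum_power_telescope_char3[OF char, of w n] w unfolding T_def z_def by simp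
  have "(\<Sum>j<n. \<Sum>k<n. z ^ ((3 ^ j + 3 ^ k) div 2)) = z * (T * T)"
    by (simp add: odd_add_div_2 power_add T_def sum_product)
      (simp only: sum_distrib_left)
  also have "\<dots> = w * ((w - 1) * T)\<^sup>2"
    by (simp add: z_def power2_eq_square mult_ac)
  finally show ?thesis
    by (simp add: T z_def)
qed

theorem theorem8:
  fixes \<alpha> \<beta> \<theta> :: "'a::{field,finite}" and n t m s :: nat
  assumes "n \<ge> 1" and "t \<ge> 1"
    and "CARD('a) = 3 ^ n"
    and "\<alpha> \<noteq> 0" and "\<beta> \<noteq> 0" and "\<theta> \<noteq> 0"
    and "bij (f_map t \<alpha> \<beta> \<theta>)"
    and "m \<in> {0, 1}" and "quadratic_character \<alpha> = (- 1) ^ m"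
    and "s \<ge> 1" and "[s * t = 1] (mod ((3 ^ n - 1) div 2))"
  shows "is_inverse_poly (f_inverse_poly n m s \<alpha> \<beta> \<theta>) (f_map t \<alpha> \<beta> \<theta>)"
proof -
  let ?h = "(3 ^ n - 1) div 2 :: nat"
  let ?f = "f_map t \<alpha> \<beta> \<theta>"
  have card: "CARD('a) = 3 ^ n" and odd: "odd CARD('a)"
    using assms(3) by simp_all
  have h: "?h = 3 ^ n div 2"
    using odd card by presburger
  have char: "CHAR('a) = 3"
    using CHAR_eq_3[OF card] .
  have three: "(3::'a) = 0"
    using of_nat_CHAR[where 'a='a] char by simp
  then have two: "(2::'a) = - 1"
    by (simp add: eq_neg_iff_add_eq_0)
  have inj: "?f x = ?f y \<Longrightarrow> x = y" for x y
    using bij_is_inj[OF assms(7)] by (auto dest: injD)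
  have f0: "?f 0 = 0"
    by (simp add: f_map_def)
  have nz: "?f c \<noteq> 0" if "c \<noteq> 0" for c
    using inj[of c 0] f0 that by auto
  have C0_nz: "x \<noteq> 0" if "x \<in> C0" for x :: 'a
    using that by (auto simp: C0_def)
  have C0_pow: "x ^ k \<in> C0" if "x \<in> C0" for x :: 'a and k
  proof -
    from that obtain e where "x = e\<^sup>2" "e \<noteq> 0"
      by (auto simp: C0_def)
    then have "x ^ k = (e ^ k)\<^sup>2" "e ^ k \<noteq> 0"
      by (simp_all add: mult.commute flip: power_mult)
    then show ?thesis
      by (auto simp: C0_def)
  qed
  have pow_st: "x ^ (s * t) = x" if "x \<in> C0" for x :: 'a
  proof -
    have x: "x ^ ?h = 1"
      using C0_imp_power_half[OF odd that] card by simp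
    \<comment> \<open>Comparing residues also covers \<open>?h = 1\<close>, where 1 reduces to
      0.\<close>
    have "x ^ k = x ^ (k mod ?h)" for k
      using arg_cong[OF mult_div_mod_eq[of ?h k], of "power x"]
      by (simp only: power_add power_mult x power_one mult_1)
    from this[of "s * t"] this[of 1] show ?thesis
      using assms(11)[unfolded cong_def] by (simp only: power_one_right)
  qed
  have \<alpha>: "\<alpha> ^ ?h = (- 1) ^ m"
    using quadratic_character_eq_power_half[OF odd assms(4)] assms(9) card by simp
  have sgn: "(- 1) ^ m * (- 1) ^ m = (1::'a)"
    by (simp flip: power_add)
  have poly_g: "poly (f_inverse_poly n m s \<alpha> \<beta> \<theta>) y =
      - ((y / \<alpha>) ^ s * (1 + (- 1) ^ m * y ^ ?h))
      - \<theta> * (\<Sum>j<n. \<Sum>k<n. (y / (\<beta> * \<theta> ^ 3)) ^ ((3 ^ j + 3 ^ k) div 2)) *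
        (1 - (- 1) ^ m * y ^ ?h)" for y
  proof -
    have "{0..n - 1} = {..<n}"
      using assms(1) by auto
    then show ?thesis
      by (simp add: f_inverse_poly_def u_poly_def v_poly_def poly_sum poly_monom
          sum_distrib_left divide_inverse)
  qed
  have "poly (f_inverse_poly n m s \<alpha> \<beta> \<theta>) (?f c) = c" for c
  proof -
    consider "c = 0" | "c \<in> C0" | "c \<noteq> 0" "c \<notin> C0"
      by blast
    then show ?thesis
    proof cases
      case 1
      \<comment> \<open>These exponents and s are all at least 1, so no \<open>0^0 = 1\<close>
        arises.\<close>
      have "(\<Sum>j<n. \<Sum>k<n. (0 / (\<beta> * \<theta> ^ 3)) ^ ((3 ^ j + 3 ^ k) div 2)) = 0"
        by (simp add: odd_add_div_2)
      then show ?thesis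
        using assms(10) unfolding 1 f0 poly_g by (simp add: power_0_left)
    next
      case 2
      then have fc: "?f c = \<alpha> * c ^ t"
        using C0_nz by (simp add: f_map_def)
      have "(c ^ t) ^ ?h = 1"
        using C0_imp_power_half[OF odd C0_pow[OF 2]] card by simp
      then have "(- 1) ^ m * ?f c ^ ?h = 1"
        unfolding fc power_mult_distrib \<alpha> by (simp add: sgn)
      moreover have "(?f c / \<alpha>) ^ s = c"
        using pow_st[OF 2] assms(4) by (simp add: fc mult.commute flip: power_mult)
      \<comment> \<open>The factor of v vanishes; that of u is \<open>2 = - 1\<close>, which cancels
        the leading minus sign.\<close>
      ultimately show ?thesis
        by (simp add: poly_g two)
    next
      case 3
      define w where "w = c / \<theta>"
      have \<theta>: "\<theta> \<in> C0"
      proof (rule ccontr)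
        assume "\<theta> \<notin> C0"
        then have "?f \<theta> = \<beta> * (3 * \<theta> ^ 3)"
          using assms(6) by (simp add: f_map_def power2_eq_square power3_eq_cube algebra_simps)
        then show False
          using nz[OF assms(6)] three by simp
      qed
      have "w ^ ?h = - 1"
        using power_half_eq_minus_1[OF odd 3] C0_imp_power_half[OF odd \<theta>] card
        by (simp add: w_def power_divide)
      then have w: "w ^ (3 ^ n div 2) = - 1"
        by (simp only: h)
      \<comment> \<open>If this quotient x were a square, so would be \<open>x^s\<close>, which the
        first branch sends to \<open>?f c\<close>; injectivity would make c a square.\<close>
      have "?f c / \<alpha> \<notin> C0"
      proof
        assume C0: "?f c / \<alpha> \<in> C0"
        then have "?f ((?f c / \<alpha>) ^ s) = ?f c"
          using C0_nz[OF C0_pow[OF C0]] C0_pow[OF C0] pow_st[OF C0] assms(4)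
          by (simp add: f_map_def[of t \<alpha> \<beta> \<theta> "_ ^ s"] power_mult)
        then have "(?f c / \<alpha>) ^ s = c"
          by (rule inj)
        then show False
          using C0_pow[OF C0] 3 by metis
      qed
      then have "(?f c / \<alpha>) ^ ?h = - 1"
        using power_half_eq_minus_1[OF odd] nz[OF 3(1)] assms(4) card by simp
      then have "?f c ^ ?h = - ((- 1) ^ m)"
        using assms(4) by (simp only: power_divide \<alpha>) (simp add: field_simps)
      then have sel: "(- 1) ^ m * ?f c ^ ?h = - 1"
        by (simp add: sgn)
      have "?f c / (\<beta> * \<theta> ^ 3) = w ^ 3 + w\<^sup>2 + w"
        using 3 assms(5,6)
        by (simp add: f_map_def w_def field_simps power2_eq_square power3_eq_cube)
      also have "\<dots> = w * (w - 1)\<^sup>2 + 3 * w\<^sup>2"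
        by (simp add: power2_eq_square power3_eq_cube algebra_simps)
      finally have z: "?f c / (\<beta> * \<theta> ^ 3) = w * (w - 1)\<^sup>2"
        by (simp add: three)
      \<comment> \<open>Now the factor of u vanishes, and what remains is
        \<open>\<theta> * w = c\<close>.\<close>
      show ?thesis
        unfolding poly_g sel z double_sum_char3[OF char w]
        using assms(6) by (simp add: two w_def)
    qed
  qed
  then show ?thesis
    by (simp add: is_inverse_poly_def)
qed

end
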